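(* Let $D=\frac d{dz}$ and define linear differential operators $M_0=(1-z)D-1$, $M_1=(1-2z)D^2-(3-z)D$, and $M_k=M_{k-1}\,D-M_{k-2}\,(D^2z-zD)$ for $k\ge2$. Then for every $k\ge0$ the exponential generating function $C_k(z)=\sum_{n\ge0}c_{k,n}\frac{z^n}{n!}$ of compacted binary trees with right height at most $k$ satisfies $M_k\cdot C_k(z)=0$.
   Context: Operators compose as products, $z$ acts by multiplication, $D^2z$ is $F\mapsto(zF)''$ and $zD$ is $F\mapsto zF'$. A full binary tree is a rooted plane tree whose nodes have $0$ or $2$ ordered children; a fringe subtree is a node with all descendants. The compacted tree of a full binary tree $T$ is the DAG obtained by post-order traversal (left, right, node), replacing each edge leading to a fringe subtree identical to one seen earlier by a pointer to the first occurrence and deleting the duplicate; its size is its number of internal nodes, and distinct $T$ give distinct compacted trees. The spine is the compacted tree without pointers and leaf; the right height is the maximal number of right spine edges on a path from the root to a spine node. $c_{k,n}$ counts compacted trees of size $n$ with right height at most $k$. *)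

theory Defs
  imports "HOL-Library.Tree" "HOL-Computational_Algebra.Formal_Power_Series"
begin

text \<open>A full binary tree is an unlabelled \<open>unit tree\<close>: \<open>Leaf\<close> is a node with 0 children,
  \<open>\<langle>l, (), r\<rangle>\<close> a node with 2 ordered children. Nodes are addressed by the path from the root.\<close>

datatype dir = Lft | Rgt

type_synonym pos = "dir list"

text \<open>All nodes in post-order (left, right, node), each with the fringe subtree rooted there.\<close>

fun occurrences :: "unit tree \<Rightarrow> (pos \<times> unit tree) list" where
  "occurrences Leaf = [([], Leaf)]"
| "occurrences (Node l a r) =
     map (\<lambda>(p, s). (Lft # p, s)) (occurrences l) @
     map (\<lambda>(p, s). (Rgt # p, s)) (occurrences r) @ [([], Node l a r)]"

text \<open>Only meaningful if \<open>s \<in> subtrees t\<close>.\<close>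

definition first_occ :: "unit tree \<Rightarrow> unit tree \<Rightarrow> pos" where
  "first_occ t s = fst (the (List.find (\<lambda>(p, s'). s' = s) (occurrences t)))"

datatype arc_kind = Edge | Pointer

record cdag =
  dag_root :: pos
  verts :: "pos set"
  arcs :: "(pos \<times> dir \<times> arc_kind \<times> pos) set"

text \<open>The vertices that survive compaction are the first occurrences of the fringe subtrees, and
  keep their positions in \<open>t\<close> as names. The edge from \<open>p\<close> to its child at \<open>p @ [d]\<close> stays an edge
  if the child is itself a first occurrence; otherwise it becomes a pointer to the first occurrence.
  Since non-pointer edges form a plane tree and the name of a vertex is its path from the root in
  that tree, the names are determined by the plane DAG: equality of these records is
  isomorphism of compacted trees.\<close>

definition compact :: "unit tree \<Rightarrow> cdag" where
  "compact t =
    \<lparr>dag_root = [],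
     verts = first_occ t ` subtrees t,
     arcs = {(p, d, if q = p @ [d] then Edge else Pointer, q) | p d q.
       \<exists>l r. Node l () r \<in> subtrees t \<and> p = first_occ t (Node l () r) \<and>
         q = first_occ t (case d of Lft \<Rightarrow> l | Rgt \<Rightarrow> r)}\<rparr>"

definition internal :: "cdag \<Rightarrow> pos set" where
  "internal G = {u \<in> verts G. \<exists>d k v. (u, d, k, v) \<in> arcs G}"

definition dag_size :: "cdag \<Rightarrow> nat" where
  "dag_size G = card (internal G)"

text \<open>The spine: vertex set \<open>internal G\<close> (the leaf is dropped), pointers removed.\<close>

definition spine_edges :: "cdag \<Rightarrow> (pos \<times> dir \<times> pos) set" where
  "spine_edges G = {(u, d, v). (u, d, Edge, v) \<in> arcs G \<and> u \<in> internal G \<and> v \<in> internal G}"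

inductive spine_path :: "cdag \<Rightarrow> pos \<Rightarrow> dir list \<Rightarrow> pos \<Rightarrow> bool" for G where
  "u \<in> internal G \<Longrightarrow> spine_path G u [] u"
| "(u, d, v) \<in> spine_edges G \<Longrightarrow> spine_path G v ds w \<Longrightarrow> spine_path G u (d # ds) w"

text \<open>The \<open>insert 0\<close> only matters for the compacted tree of size 0, whose spine is empty.\<close>

definition right_height :: "cdag \<Rightarrow> nat" where
  "right_height G = Max (insert 0 {count_list ds Rgt | ds v. spine_path G (dag_root G) ds v})"

definition num_compacted :: "nat \<Rightarrow> nat \<Rightarrow> nat" where
  "num_compacted k n = card {G \<in> range compact. dag_size G = n \<and> right_height G \<le> k}"

definition C_egf :: "nat \<Rightarrow> real fps" where
  "C_egf k = Abs_fps (\<lambda>n. of_nat (num_compacted k n) / fact n)"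

abbreviation D :: "real fps \<Rightarrow> real fps" where
  "D \<equiv> fps_deriv"

text \<open>Products of operators are compositions, with the right factor acting first.\<close>

fun M_op :: "nat \<Rightarrow> real fps \<Rightarrow> real fps" where
  "M_op 0 = (\<lambda>F. (1 - fps_X) * D F - F)"
| "M_op (Suc 0) = (\<lambda>F. (1 - 2 * fps_X) * D (D F) - (3 - fps_X) * D F)"
| "M_op (Suc (Suc k)) =
     (\<lambda>F. M_op (Suc k) (D F) - M_op k (D (D (fps_X * F)) - fps_X * D F))"

end

theory Submission
  imports Defs
begin

text \<open>Compaction visits the nodes in post-order while the set \<open>S\<close> of fringe subtrees seen so far
  grows. The number of trees that contribute \<open>m\<close> new internal nodes depends on \<open>S\<close> only through
  its number \<open>s\<close> of internal nodes, and splitting a new tree at its root gives the recurrence of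
  \<open>ext_count\<close>; the subtracted \<open>s\<close> are the pairs of known children whose parent is known as well.
  Let \<open>\<Phi>\<^sub>h\<close> be the operator sending \<open>z\<^sup>s/s!\<close> to \<open>\<Sum>\<^sub>m ext_count h m s z\<^sup>s\<^sup>+\<^sup>m/(s+m)!\<close>, where \<open>h = k + 1\<close>.
  The recurrence becomes \<open>(D - \<Phi>\<^sub>h) \<Phi>\<^sub>h\<^sub>+\<^sub>1 = D\<^sup>2z - zD\<close>. Since \<open>M\<^sub>0 = D - \<Phi>\<^sub>0\<close>, induction yields
  \<open>M\<^sub>k\<^sub>+\<^sub>1 = M\<^sub>k (D - \<Phi>\<^sub>k\<^sub>+\<^sub>1)\<close>, and \<open>C\<^sub>k = \<Phi>\<^sub>k\<^sub>+\<^sub>1 1\<close> is annihilated because \<open>(D\<^sup>2z - zD) 1 = 0\<close>.\<close>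

section \<open>First occurrences\<close>

lemma snd_occurrences: "snd ` set (occurrences t) = subtrees t"
  by (induction t) (auto simp: image_iff split: prod.splits; force)+

lemma subtrees_self [simp]: "t \<in> subtrees t"
  by (cases t) auto

lemma finite_subtrees [simp]: "finite (subtrees t)"
  by (induction t) auto

lemma subtrees_trans: "s \<in> subtrees t \<Longrightarrow> subtrees s \<subseteq> subtrees t"
  by (induction t) auto

lemma Leaf_in_subtrees [simp]: "Leaf \<in> subtrees t"
  by (induction t) auto

lemma size_subtrees: "s \<in> subtrees t \<Longrightarrow> size s \<le> size t"
  by (induction t) auto

lemma Node_notin_subtrees [simp]:
  "Node l a r \<notin> subtrees l" "Node l a r \<notin> subtrees r"
  using size_subtrees[of "Node l a r"] by fastforce+

lemma find_append:
  "List.find P (xs @ ys) = (case List.find P xs of None \<Rightarrow> List.find P ys | Some x \<Rightarrow> Some x)"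
  by (induction xs) auto

lemma find_map: "List.find P (map f xs) = map_option f (List.find (P \<circ> f) xs)"
  by (induction xs) auto

lemma find_occurrences:
  "List.find (\<lambda>(p, s'). s' = s) (occurrences t) =
     (if s \<in> subtrees t then Some (first_occ t s, s) else None)"
proof (cases "List.find (\<lambda>(p, s'). s' = s) (occurrences t)")
  case None
  then show ?thesis
    unfolding snd_occurrences[symmetric] by (auto simp: find_None_iff)
next
  case (Some x)
  then have "x \<in> set (occurrences t)" "snd x = s"
    by (auto simp: find_Some_iff in_set_conv_nth)
  then show ?thesis
    unfolding snd_occurrences[symmetric] using Some
    by (auto simp: first_occ_def)
qed

lemma first_occ_Leaf [simp]: "first_occ Leaf Leaf = []"
  by (simp add: first_occ_def)

text \<open>Post-order runs through \<open>l\<close>, then \<open>r\<close>, then the root, so the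
  earliest occurrence is sought in that order.\<close>

lemma first_occ_Node:
  assumes "s \<in> subtrees (Node l a r)"
  shows "first_occ (Node l a r) s =
    (if s \<in> subtrees l then Lft # first_occ l s
     else if s \<in> subtrees r then Rgt # first_occ r s else [])"
proof -
  have comp: "(\<lambda>(p, s'). s' = s) \<circ> (\<lambda>(p, s). (f p, s)) = (\<lambda>(p, s'). s' = s)"
    for f :: "pos \<Rightarrow> pos"
    by auto
  show ?thesis
    using assms
    by (subst first_occ_def) (auto simp: find_append find_map comp find_occurrences)
qed

lemma first_occ_self [simp]: "first_occ t t = []"
  by (cases t) (auto simp: first_occ_Node)

lemma inj_on_first_occ: "inj_on (first_occ t) (subtrees t)"
proof (induction t)
  case Leaf
  then show ?case by simp
next
  case (Node l a r)
  show ?case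
  proof (rule inj_onI)
    fix x y
    assume "x \<in> subtrees (Node l a r)" "y \<in> subtrees (Node l a r)"
      "first_occ (Node l a r) x = first_occ (Node l a r) y"
    then show "x = y"
      by (auto simp: first_occ_Node split: if_splits dest: inj_onD[OF Node.IH(1)] inj_onD[OF Node.IH(2)])
  qed
qed

text \<open>If the parent's subtree had occurred earlier, so would its child \<open>s\<close>. Hence
  walking up from a surviving vertex never leaves the surviving vertices.\<close>

lemma first_occ_parent:
  assumes "s \<in> subtrees t" "first_occ t s = u @ [d]"
  shows "\<exists>l r. Node l () r \<in> subtrees t \<and> u = first_occ t (Node l () r) \<and>
           s = (case d of Lft \<Rightarrow> l | Rgt \<Rightarrow> r)"
  using assms
proof (induction t arbitrary: u)
  case Leaf
  then show ?case by simp
next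
  case (Node l a r)
  consider "s \<in> subtrees l" | "s \<notin> subtrees l" "s \<in> subtrees r" | "s = Node l a r"
    using Node.prems(1) by auto
  then show ?case
  proof cases
    case 1
    then have occ: "Lft # first_occ l s = u @ [d]"
      using Node.prems by (simp add: first_occ_Node)
    show ?thesis
    proof (cases u)
      case Nil
      then have "first_occ l s = first_occ l l" "d = Lft"
        using occ by auto
      then have "s = l"
        using inj_onD[OF inj_on_first_occ] 1 by (metis subtrees_self)
      then show ?thesis
        using Nil \<open>d = Lft\<close> by (intro exI[of _ l] exI[of _ r]) simp
    next
      case (Cons e v)
      then have "first_occ l s = v @ [d]" "u = Lft # v"
        using occ by auto
      with Node.IH(1)[OF 1] obtain l' r' where
        "Node l' () r' \<in> subtrees l" "v = first_occ l (Node l' () r')"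
        "s = (case d of Lft \<Rightarrow> l' | Rgt \<Rightarrow> r')"
        by blast
      then show ?thesis
        using \<open>u = Lft # v\<close> by (intro exI[of _ l'] exI[of _ r']) (simp add: first_occ_Node)
    qed
  next
    case 2
    then have occ: "Rgt # first_occ r s = u @ [d]"
      using Node.prems by (simp add: first_occ_Node)
    show ?thesis
    proof (cases u)
      case Nil
      then have "first_occ r s = first_occ r r" "d = Rgt"
        using occ by auto
      then have "s = r"
        using inj_onD[OF inj_on_first_occ] 2 by (metis subtrees_self)
      then show ?thesis
        using Nil \<open>d = Rgt\<close> by (intro exI[of _ l] exI[of _ r]) simp
    next
      case (Cons e v)
      then have "first_occ r s = v @ [d]" "u = Rgt # v"
        using occ by auto
      with Node.IH(2)[OF 2(2)] obtain l' r' where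
        *: "Node l' () r' \<in> subtrees r" "v = first_occ r (Node l' () r')"
          "s = (case d of Lft \<Rightarrow> l' | Rgt \<Rightarrow> r')"
        by blast
      \<comment> \<open>If the parent occurred in \<open>l\<close>, its child \<open>s\<close> would
        too, against the case assumption.\<close>
      have "s \<in> subtrees (Node l' () r')"
        using *(3) by (cases d) auto
      then have "Node l' () r' \<notin> subtrees l"
        using 2(1) subtrees_trans by blast
      then show ?thesis
        using * \<open>u = Rgt # v\<close> by (intro exI[of _ l'] exI[of _ r']) (simp add: first_occ_Node)
    qed
  next
    case 3
    then show ?thesis
      using Node.prems(2) by simp
  qed
qed

section \<open>The compacted tree\<close>

lemma arcs_compact_iff:
  "(p, d, e, q) \<in> arcs (compact t) \<longleftrightarrow>
     (\<exists>l r. Node l () r \<in> subtrees t \<and> p = first_occ t (Node l () r) \<and>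
        q = first_occ t (case d of Lft \<Rightarrow> l | Rgt \<Rightarrow> r)) \<and>
     e = (if q = p @ [d] then Edge else Pointer)"
  by (auto simp: compact_def)

lemma children_in_subtrees:
  assumes "Node l a r \<in> subtrees t"
  shows "l \<in> subtrees t" "r \<in> subtrees t"
  using subtrees_trans[OF assms] by auto

lemma internal_compact: "internal (compact t) = first_occ t ` (subtrees t - {Leaf})"
proof (intro set_eqI iffI)
  fix u
  assume "u \<in> internal (compact t)"
  then show "u \<in> first_occ t ` (subtrees t - {Leaf})"
    unfolding internal_def arcs_compact_iff by blast
next
  fix u
  assume "u \<in> first_occ t ` (subtrees t - {Leaf})"
  then obtain s where "s \<in> subtrees t" "s \<noteq> Leaf" "u = first_occ t s"
    by blast
  then obtain l r where lr: "Node l () r \<in> subtrees t" "u = first_occ t (Node l () r)"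
    by (cases s) auto
  then have "u \<in> verts (compact t)"
    by (simp add: compact_def)
  moreover have "\<exists>d k v. (u, d, k, v) \<in> arcs (compact t)"
    unfolding arcs_compact_iff using lr by blast
  ultimately show "u \<in> internal (compact t)"
    by (simp add: internal_def)
qed

section \<open>Size of the compacted tree and injectivity of compaction\<close>

lemma dag_size_compact: "dag_size (compact t) = card (subtrees t - {Leaf})"
  unfolding dag_size_def internal_compact
  by (intro card_image inj_on_subset[OF inj_on_first_occ]) auto

text \<open>The tree at a vertex can be rebuilt from the DAG: only the leaf has no outgoing arcs,
  and the arcs of a node, edges and pointers alike, lead to the first occurrences of its
  children.\<close>

lemma first_occ_eq_if_compact_eq:
  assumes "compact t = compact t'"
    and "s \<in> subtrees t" "s' \<in> subtrees t'" "first_occ t s = first_occ t' s'"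
  shows "s = s'"
  using assms(2-4)
proof (induction s arbitrary: s')
  case Leaf
  show ?case
  proof (rule ccontr)
    assume "Leaf \<noteq> s'"
    then have "first_occ t' s' \<in> internal (compact t)"
      unfolding assms(1) internal_compact using Leaf by blast
    then obtain s where "s \<in> subtrees t" "s \<noteq> Leaf" "first_occ t s = first_occ t Leaf"
      unfolding internal_compact using Leaf.prems(3) by force
    then show False
      using inj_onD[OF inj_on_first_occ] Leaf.prems(1) by metis
  qed
next
  case (Node l a r)
  have "\<exists>l' r'. s' = Node l' () r' \<and>
      first_occ t (case d of Lft \<Rightarrow> l | Rgt \<Rightarrow> r) = first_occ t' (case d of Lft \<Rightarrow> l' | Rgt \<Rightarrow> r')" for d
  proof -
    let ?c = "case d of Lft \<Rightarrow> l | Rgt \<Rightarrow> r"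
    have "\<exists>e. (first_occ t (Node l a r), d, e, first_occ t ?c) \<in> arcs (compact t)"
      unfolding arcs_compact_iff using Node.prems(1) by auto
    then obtain l' r' where *: "Node l' () r' \<in> subtrees t'"
      "first_occ t' s' = first_occ t' (Node l' () r')"
      "first_occ t ?c = first_occ t' (case d of Lft \<Rightarrow> l' | Rgt \<Rightarrow> r')"
      unfolding assms(1) arcs_compact_iff Node.prems(3) by blast
    have "s' = Node l' () r'"
      using inj_onD[OF inj_on_first_occ *(2)] Node.prems(2) *(1) by simp
    then show ?thesis
      using *(3) by blast
  qed
  from this[of Lft] this[of Rgt] obtain l' r' where
    *: "s' = Node l' () r'" "first_occ t l = first_occ t' l'" "first_occ t r = first_occ t' r'"
    by auto
  have "l = l'" "r = r'"
    using Node.IH(1)[OF _ _ *(2)] Node.IH(2)[OF _ _ *(3)]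
      children_in_subtrees[OF Node.prems(1)] children_in_subtrees[of l' "()" r' t']
      Node.prems(2) *(1) by auto
  then show ?case
    using *(1) by simp
qed

lemma inj_compact: "inj compact"
  by (rule injI) (rule first_occ_eq_if_compact_eq[OF _ subtrees_self subtrees_self], auto)

section \<open>Spine paths and right height\<close>

lemma spine_path_compactD:
  assumes "spine_path (compact t) u ds w"
  shows "w = u @ ds \<and> w \<in> internal (compact t)"
  using assms
  by induction (auto simp: spine_edges_def arcs_compact_iff split: if_splits)

lemma spine_path_compactI:
  assumes "u @ ds \<in> internal (compact t)"
  shows "spine_path (compact t) u ds (u @ ds)"
  using assms
proof (induction ds arbitrary: u rule: rev_induct)
  case Nil
  then show ?case
    by (auto intro: spine_path.intros)
next
  case (snoc d ds)
  have "(u @ ds) @ [d] \<in> first_occ t ` (subtrees t - {Leaf})"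
    using snoc.prems by (simp add: internal_compact)
  then obtain s where occ: "(u @ ds) @ [d] = first_occ t s" and s: "s \<in> subtrees t - {Leaf}"
    by (rule imageE)
  from s first_occ_parent[OF _ occ[symmetric]] obtain l r where
    lr: "Node l () r \<in> subtrees t" "u @ ds = first_occ t (Node l () r)"
      "s = (case d of Lft \<Rightarrow> l | Rgt \<Rightarrow> r)"
    by blast
  have "(u @ ds, d, Edge, (u @ ds) @ [d]) \<in> arcs (compact t)"
    unfolding arcs_compact_iff using lr occ by metis
  moreover have int: "u @ ds \<in> internal (compact t)"
    unfolding internal_compact lr(2) using lr(1) by blast
  ultimately have "(u @ ds, d, (u @ ds) @ [d]) \<in> spine_edges (compact t)"
    using snoc.prems by (simp add: spine_edges_def)
  \<comment> \<open>\<open>spine_path\<close> grows at its front, so appending an edge at the end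
    needs its own induction.\<close>
  moreover have "spine_path G v (ds @ [d]) w"
    if "spine_path G v ds v'" "(v', d, w) \<in> spine_edges G" for G v v' w
    using that
    by (induction) (auto intro!: spine_path.intros simp: spine_edges_def)
  ultimately show ?case
    using snoc.IH[OF int] by simp
qed

lemma right_height_compact_le_iff:
  "right_height (compact t) \<le> k \<longleftrightarrow>
     (\<forall>s \<in> subtrees t - {Leaf}. count_list (first_occ t s) Rgt \<le> k)"
proof -
  have "{count_list ds Rgt |ds v. spine_path (compact t) (dag_root (compact t)) ds v} =
      (\<lambda>p. count_list p Rgt) ` internal (compact t)"
    using spine_path_compactI[of "[]"] spine_path_compactD[of t "[]"]
    by (fastforce simp: compact_def[of t, THEN arg_cong[of _ _ dag_root]])
  then show ?thesis
    by (simp add: right_height_def internal_compact image_image)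
qed

section \<open>Counting trees relative to the subtrees seen so far\<close>

text \<open>Such an \<open>S\<close> models what the traversal has seen: post-order visits
  descendants before their ancestor, and its first node is a leaf.\<close>

definition subtree_closed :: "unit tree set \<Rightarrow> bool" where
  "subtree_closed S \<longleftrightarrow> finite S \<and> Leaf \<in> S \<and> (\<forall>t\<in>S. subtrees t \<subseteq> S)"

lemma subtree_closed_Un:
  "subtree_closed S \<Longrightarrow> subtree_closed (S \<union> subtrees t)"
  unfolding subtree_closed_def using subtrees_trans by fastforce

lemma subtrees_subset_iff: "subtree_closed S \<Longrightarrow> subtrees t \<subseteq> S \<longleftrightarrow> t \<in> S"
  unfolding subtree_closed_def using subtrees_self by blast

lemma subtree_closed_NodeD:
  "subtree_closed S \<Longrightarrow> Node l a r \<in> S \<Longrightarrow> l \<in> S \<and> r \<in> S"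
  using subtrees_subset_iff[of S "Node l a r"] subtrees_subset_iff[of S l] subtrees_subset_iff[of S r]
  by simp

text \<open>The bound \<open>h\<close> is strict, so that \<open>h = 0\<close> forces a pointer into \<open>S\<close>; right height at most \<open>k\<close>
  corresponds to \<open>h = k + 1\<close>.\<close>

fun fits :: "nat \<Rightarrow> unit tree set \<Rightarrow> unit tree \<Rightarrow> bool" where
  "fits 0 S t \<longleftrightarrow> t \<in> S"
| "fits (Suc h) S Leaf \<longleftrightarrow> True"
| "fits (Suc h) S (Node l a r) \<longleftrightarrow>
     Node l a r \<in> S \<or> fits (Suc h) S l \<and> fits h (S \<union> subtrees l) r"

lemma fits_known: "subtree_closed S \<Longrightarrow> t \<in> S \<Longrightarrow> fits h S t"
  by (cases "(h, S, t)" rule: fits.cases) auto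

text \<open>A new subtree of \<open>Node l a r\<close> is the whole tree, a new subtree of
  \<open>l\<close>, or a subtree of \<open>r\<close> still new after \<open>l\<close>. Only the last
  kind gains a right edge, which costs one unit of the bound.\<close>

lemma fits_iff:
  assumes "subtree_closed S"
  shows "fits h S t \<longleftrightarrow> (\<forall>s \<in> subtrees t - S. count_list (first_occ t s) Rgt < h)"
  using assms
proof (induction h S t rule: fits.induct)
  case (1 S t)
  then show ?case
    using subtrees_subset_iff[of S t] by auto
next
  case (2 h S)
  then show ?case
    by (simp add: subtree_closed_def)
next
  case (3 h S l a r)
  show ?case
  proof (cases "Node l a r \<in> S")
    case True
    then have "subtrees (Node l a r) \<subseteq> S"
      using subtrees_subset_iff 3 by blast
    with True show ?thesis by auto
  next
    case False
    have "subtrees (Node l a r) - S =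
        insert (Node l a r) ((subtrees l - S) \<union> (subtrees r - (S \<union> subtrees l)))"
      using False by auto
    then have "(\<forall>s \<in> subtrees (Node l a r) - S. count_list (first_occ (Node l a r) s) Rgt < Suc h) \<longleftrightarrow>
        (\<forall>s \<in> subtrees l - S. count_list (first_occ l s) Rgt < Suc h) \<and>
        (\<forall>s \<in> subtrees r - (S \<union> subtrees l). count_list (first_occ r s) Rgt < h)"
      by (simp add: ball_Un first_occ_Node)
    also have "\<dots> \<longleftrightarrow> fits (Suc h) S (Node l a r)"
      using 3 False subtree_closed_Un by auto
    finally show ?thesis ..
  qed
qed

section \<open>A recurrence for the number of trees adding \<open>m\<close> internal nodes\<close>

context
  notes sum.cong [fundef_cong]
begin

text \<open>\<open>s + 1\<close> is the size of a closed set with \<open>s\<close> internal nodes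
  and the leaf. Real values keep the subtraction from being truncated; the congruence rule supplies
  \<open>i \<le> m\<close> to the termination proof.\<close>

fun ext_count :: "nat \<Rightarrow> nat \<Rightarrow> nat \<Rightarrow> real" where
  "ext_count 0 m s = (if m = 0 then of_nat (s + 1) else 0)"
| "ext_count (Suc h) 0 s = of_nat (s + 1)"
| "ext_count (Suc h) (Suc m) s =
     (\<Sum>i\<le>m. ext_count (Suc h) i s * ext_count h (m - i) (s + i)) - (if m = 0 then of_nat s else 0)"

end

definition exts :: "nat \<Rightarrow> unit tree set \<Rightarrow> nat \<Rightarrow> unit tree set" where
  "exts h S m = {t. fits h S t \<and> card (subtrees t - S) = m}"

lemma new_subtrees_empty_iff:
  "subtree_closed S \<Longrightarrow> card (subtrees t - S) = 0 \<longleftrightarrow> t \<in> S"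
  using subtrees_subset_iff[of S t] by auto

lemma exts_0: "subtree_closed S \<Longrightarrow> exts h S 0 = S"
  unfolding exts_def using new_subtrees_empty_iff fits_known by auto

lemma card_new_subtrees_Node:
  assumes "Node l a r \<notin> S"
  shows "card (subtrees (Node l a r) - S) =
    Suc (card (subtrees l - S) + card (subtrees r - (S \<union> subtrees l)))"
proof -
  have "subtrees (Node l a r) - S =
      insert (Node l a r) ((subtrees l - S) \<union> (subtrees r - (S \<union> subtrees l)))"
    using assms by auto
  moreover have "card ((subtrees l - S) \<union> (subtrees r - (S \<union> subtrees l))) =
      card (subtrees l - S) + card (subtrees r - (S \<union> subtrees l))"
    by (rule card_Un_disjoint) auto
  ultimately show ?thesis
    by simp
qed

text \<open>A tree with a new subtree is new itself, so its root accounts for one of the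
  \<open>Suc m\<close>; the other \<open>m\<close> split between \<open>l\<close> and what
  \<open>r\<close> adds after \<open>l\<close>. Removing \<open>S\<close> discards pairs whose
  parent is known.\<close>

lemma exts_Suc:
  assumes "subtree_closed S"
  shows "exts (Suc h) S (Suc m) =
    (\<lambda>(l, r). Node l () r) `
      (\<Union>i\<le>m. SIGMA l : exts (Suc h) S i. exts h (S \<union> subtrees l) (m - i)) - S"
    (is "_ = ?f ` ?P - S")
proof (intro set_eqI iffI)
  fix t
  assume "t \<in> exts (Suc h) S (Suc m)"
  then have t: "fits (Suc h) S t" "card (subtrees t - S) = Suc m"
    by (auto simp: exts_def)
  then have "t \<notin> S"
    using new_subtrees_empty_iff[OF assms, of t] by simp
  moreover from this assms obtain l r where lr: "t = Node l () r"
    by (cases t) (auto simp: subtree_closed_def)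
  ultimately have "card (subtrees l - S) + card (subtrees r - (S \<union> subtrees l)) = m"
    "fits (Suc h) S l" "fits h (S \<union> subtrees l) r"
    using t card_new_subtrees_Node[of l "()" r S] by auto
  then have "(l, r) \<in> ?P"
    by (intro UN_I[of "card (subtrees l - S)"]) (auto simp: exts_def)
  then show "t \<in> ?f ` ?P - S"
    using lr \<open>t \<notin> S\<close> by force
next
  fix t
  assume "t \<in> ?f ` ?P - S"
  then show "t \<in> exts (Suc h) S (Suc m)"
    by (auto simp: exts_def card_new_subtrees_Node simp del: subtrees.simps)
qed

lemma card_nodes_closed:
  assumes "subtree_closed S" "card S = Suc s"
  shows "card (S - {Leaf}) = s"
  using assms by (simp add: subtree_closed_def)

text \<open>An \<open>l\<close> with \<open>i\<close> new subtrees turns \<open>S\<close> into a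
  closed set with \<open>s + i\<close> internal nodes, so the induction hypothesis counts the
  choices of \<open>r\<close> whatever the shape of \<open>l\<close>.\<close>

lemma card_exts:
  assumes "subtree_closed S" "card S = Suc s"
  shows "finite (exts h S m) \<and> real (card (exts h S m)) = ext_count h m s"
  using assms
proof (induction h m s arbitrary: S rule: ext_count.induct)
  case (1 m s)
  show ?case
  proof (cases "m = 0")
    case True
    then show ?thesis
      using 1 exts_0[of S 0] by (simp add: subtree_closed_def)
  next
    case False
    then have "card (subtrees t - S) \<noteq> m" if "t \<in> S" for t
      using that new_subtrees_empty_iff[OF 1(1)] by metis
    then have "exts 0 S m = {}"
      by (auto simp: exts_def)
    then show ?thesis
      using False by simp
  qed
next
  case (2 h s)
  then show ?case
    using exts_0[of S "Suc h"] by (simp add: subtree_closed_def)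
next
  case (3 h m s)
  let ?f = "\<lambda>(l, r). Node l () r"
  define P where "P i = (SIGMA l : exts (Suc h) S i. exts h (S \<union> subtrees l) (m - i))" for i
  have closed: "subtree_closed (S \<union> subtrees l)" for l
    using subtree_closed_Un[OF 3(3)] .
  have finS: "finite S"
    using 3(3) by (simp add: subtree_closed_def)
  have card_Un: "card (S \<union> subtrees l) = Suc (s + i)" if "l \<in> exts (Suc h) S i" for l i
    using that finS 3(4) card_Un_disjoint[of S "subtrees l - S"] by (auto simp: exts_def)
  have A: "finite (exts (Suc h) S i) \<and> real (card (exts (Suc h) S i)) = ext_count (Suc h) i s"
    if "i \<le> m" for i
    using 3(1)[of i S] 3(3,4) that by simp
  have B: "finite (exts h (S \<union> subtrees l) (m - i)) \<and>
      real (card (exts h (S \<union> subtrees l) (m - i))) = ext_count h (m - i) (s + i)"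
    if "i \<le> m" "l \<in> exts (Suc h) S i" for i l
    using 3(2)[of i "S \<union> subtrees l"] closed card_Un that by simp
  have P: "finite (P i) \<and> real (card (P i)) = ext_count (Suc h) i s * ext_count h (m - i) (s + i)"
    if "i \<le> m" for i
    using A[OF that] B[OF that] by (simp add: P_def)
  have inj: "inj_on ?f X" for X
    by (auto intro: inj_onI)
  have fin: "finite (\<Union>i\<le>m. P i)"
    using P by simp
  have disj: "P i \<inter> P j = {}" if "i \<noteq> j" for i j
    using that by (auto simp: P_def exts_def)
  have cardP: "real (card (\<Union>i\<le>m. P i)) =
      (\<Sum>i\<le>m. ext_count (Suc h) i s * ext_count h (m - i) (s + i))"
    using P disj by (subst card_UN_disjoint) auto
  have eq: "exts (Suc h) S (Suc m) = ?f ` (\<Union>i\<le>m. P i) - S"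
    unfolding P_def by (rule exts_Suc[OF 3(3)])
  \<comment> \<open>A known parent has known children, so a pair can land in \<open>S\<close> only
    if nothing is new, that is for \<open>m = 0\<close>; then every non-leaf of \<open>S\<close> is
    hit, which gives the subtracted \<open>s\<close>.\<close>
  have inter: "?f ` (\<Union>i\<le>m. P i) \<inter> S = (if m = 0 then S - {Leaf} else {})"
  proof (cases "m = 0")
    case True
    have "S \<union> subtrees l = S" if "l \<in> S" for l
      using subtrees_subset_iff[OF 3(3)] that by blast
    then have "P 0 = S \<times> S"
      using True by (simp add: P_def exts_0[OF 3(3)] exts_0[OF closed] cong: Sigma_cong)
    moreover have "?f ` (S \<times> S) \<inter> S = S - {Leaf}"
    proof (intro set_eqI iffI)
      fix t
      assume "t \<in> S - {Leaf}"
      then obtain l r where t: "t = Node l () r" "t \<in> S"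
        by (cases t) auto
      then have "l \<in> S \<and> r \<in> S"
        using subtree_closed_NodeD[OF 3(3), of l "()" r] by simp
      with t show "t \<in> ?f ` (S \<times> S) \<inter> S"
        by (intro IntI image_eqI[of _ _ "(l, r)"]) auto
    qed auto
    ultimately show ?thesis
      using True by simp
  next
    case False
    have False if lr: "(l, r) \<in> P i" and N: "Node l () r \<in> S" for i l r
    proof -
      have "l \<in> S" "r \<in> S"
        using subtree_closed_NodeD[OF 3(3) N] by auto
      then have new: "subtrees l - S = {}" "subtrees r - (S \<union> subtrees l) = {}"
        using subtrees_subset_iff[OF 3(3)] by blast+
      have "card (subtrees l - S) = i" "card (subtrees r - (S \<union> subtrees l)) = m - i"
        using lr by (auto simp: P_def exts_def)
      then have "i = 0" "m - i = 0"
        unfolding new by simp_all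
      then show False
        using False by simp
    qed
    then show ?thesis
      using False by auto
  qed
  have "card (?f ` (\<Union>i\<le>m. P i)) = card (exts (Suc h) S (Suc m)) + card (?f ` (\<Union>i\<le>m. P i) \<inter> S)"
    unfolding eq using fin
    by (subst card_Un_disjoint[symmetric]) (auto intro!: arg_cong[of _ _ card])
  then have "real (card (exts (Suc h) S (Suc m))) =
      real (card (\<Union>i\<le>m. P i)) - real (card (?f ` (\<Union>i\<le>m. P i) \<inter> S))"
    by (simp add: card_image[OF inj])
  moreover have "real (card (?f ` (\<Union>i\<le>m. P i) \<inter> S)) = (if m = 0 then real s else 0)"
    unfolding inter using card_nodes_closed[OF 3(3,4)] by simp
  moreover have "finite (exts (Suc h) S (Suc m))"
    unfolding eq using fin by simp
  ultimately show ?case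
    using cardP by simp
qed

text \<open>The traversal meets a leaf first, so it may start from \<open>{Leaf}\<close>, where
  \<open>s = 0\<close>; injectivity of \<open>compact\<close> turns a count of DAGs into a count of
  trees.\<close>

lemma num_compacted_eq: "real (num_compacted k n) = ext_count (Suc k) n 0"
proof -
  have closed: "subtree_closed {Leaf}"
    by (simp add: subtree_closed_def)
  have "right_height (compact t) \<le> k \<longleftrightarrow> fits (Suc k) {Leaf} t" for t
    unfolding fits_iff[OF closed] right_height_compact_le_iff by (simp add: less_Suc_eq_le)
  then have "{G \<in> range compact. dag_size G = n \<and> right_height G \<le> k} =
      compact ` exts (Suc k) {Leaf} n"
    by (auto simp: exts_def dag_size_compact)
  then have "num_compacted k n = card (exts (Suc k) {Leaf} n)"
    unfolding num_compacted_def
    by (simp add: card_image inj_on_subset[OF inj_compact])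
  then show ?thesis
    using card_exts[OF closed, of 0 "Suc k" n] by simp
qed

section \<open>The differential operators\<close>

unbundle fps_syntax

text \<open>This is \<open>\<Phi>\<^sub>h\<close>: on the coefficients \<open>fact s * F $ s\<close>
  it acts as a lower triangular matrix with entries \<open>ext_count h (n - s) s\<close>.\<close>

definition ext_op :: "nat \<Rightarrow> real fps \<Rightarrow> real fps" where
  "ext_op h F = Abs_fps (\<lambda>n. (\<Sum>s\<le>n. ext_count h (n - s) s * fact s * F $ s) / fact n)"

lemma C_egf_eq: "C_egf k = ext_op (Suc k) 1"
proof (rule fps_ext)
  fix n
  have "(\<Sum>s\<le>n. ext_count (Suc k) (n - s) s * fact s * (1 :: real fps) $ s) =
      (\<Sum>s\<in>{0}. ext_count (Suc k) (n - s) s * fact s * (1 :: real fps) $ s)"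
    by (rule sum.mono_neutral_right) auto
  then show "C_egf k $ n = ext_op (Suc k) 1 $ n"
    by (simp add: C_egf_def ext_op_def num_compacted_eq)
qed

lemma ext_op_0: "ext_op 0 F = D (fps_X * F)"
proof (rule fps_ext)
  fix n
  have "(\<Sum>s\<le>n. ext_count 0 (n - s) s * fact s * F $ s) =
      (\<Sum>s\<in>{n}. ext_count 0 (n - s) s * fact s * F $ s)"
    by (rule sum.mono_neutral_right) auto
  then show "ext_op 0 F $ n = D (fps_X * F) $ n"
    by (simp add: ext_op_def) (simp add: algebra_simps)
qed

lemma sum_triangle_swap:
  fixes f :: "nat \<Rightarrow> nat \<Rightarrow> 'a :: comm_monoid_add"
  shows "(\<Sum>s\<le>n. \<Sum>j=s..n. f s j) = (\<Sum>j\<le>n. \<Sum>s\<le>j. f s j)"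
proof -
  have "(\<Sum>s\<le>n. \<Sum>j=s..n. f s j) = (\<Sum>s\<le>n. \<Sum>j | j \<in> {..n} \<and> s \<le> j. f s j)"
    by (intro sum.cong) auto
  also have "\<dots> = (\<Sum>j\<le>n. \<Sum>s | s \<in> {..n} \<and> s \<le> j. f s j)"
    by (rule sum.swap_restrict) auto
  also have "\<dots> = (\<Sum>j\<le>n. \<Sum>s\<le>j. f s j)"
    by (intro sum.cong) auto
  finally show ?thesis .
qed

text \<open>\<open>D\<close> shifts the index by one, which accounts for the root, and the sum over
  \<open>i\<close> becomes composition with \<open>ext_op h\<close>. There remain the correction at
  \<open>s = n\<close>, giving \<open>fps_X * D F\<close>, and the base case at
  \<open>s = Suc n\<close>, giving \<open>D (D (fps_X * F))\<close>.\<close>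

lemma deriv_ext_op_Suc:
  "D (ext_op (Suc h) F) - ext_op h (ext_op (Suc h) F) = D (D (fps_X * F)) - fps_X * D F"
proof (rule fps_ext)
  fix n
  define a where "a s = fact s * F $ s" for s
  let ?A = "\<lambda>m s. ext_count (Suc h) m s"
  let ?B = "\<lambda>m s. ext_count h m s"
  have egf: "fact j * ext_op (Suc h) F $ j = (\<Sum>s\<le>j. ?A (j - s) s * a s)" for j
    by (simp add: ext_op_def a_def mult.assoc)
  have step: "?A (Suc n - s) s = (\<Sum>i\<le>n - s. ?A i s * ?B (n - s - i) (s + i)) -
      (if s = n then real s else 0)" if "s \<le> n" for s
    using that by (auto simp: Suc_diff_le)
  \<comment> \<open>\<open>j = s + i\<close> is the number of internal nodes known after the left
    subtree.\<close>
  have conv: "(\<Sum>i\<le>n - s. ?A i s * ?B (n - s - i) (s + i)) = (\<Sum>j=s..n. ?A (j - s) s * ?B (n - j) j)"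
    if "s \<le> n" for s
    by (rule sum.reindex_bij_witness[of _ "\<lambda>j. j - s" "\<lambda>i. s + i"]) (use that in auto)
  have "(\<Sum>s\<le>n. ?A (Suc n - s) s * a s) =
      (\<Sum>s\<le>n. (\<Sum>j=s..n. ?A (j - s) s * ?B (n - j) j) * a s - (if s = n then real s * a s else 0))"
  proof (rule sum.cong[OF refl])
    fix s
    assume "s \<in> {..n}"
    then have "s \<le> n" by simp
    show "?A (Suc n - s) s * a s =
        (\<Sum>j=s..n. ?A (j - s) s * ?B (n - j) j) * a s - (if s = n then real s * a s else 0)"
      unfolding step[OF \<open>s \<le> n\<close>] conv[OF \<open>s \<le> n\<close>] by (simp add: left_diff_distrib)
  qed
  \<comment> \<open>The summand \<open>s = Suc n\<close> is the base case of the recurrence, with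
    value \<open>Suc n + 1\<close>.\<close>
  then have "(\<Sum>s\<le>Suc n. ?A (Suc n - s) s * a s) =
      (\<Sum>s\<le>n. (\<Sum>j=s..n. ?A (j - s) s * ?B (n - j) j) * a s - (if s = n then real s * a s else 0)) +
      real (n + 2) * a (Suc n)"
    by simp
  also have "\<dots> = (\<Sum>s\<le>n. \<Sum>j=s..n. ?A (j - s) s * ?B (n - j) j * a s) - real n * a n +
      real (n + 2) * a (Suc n)"
    by (simp add: sum_subtractf sum_distrib_right)
  \<comment> \<open>Grouping by \<open>j\<close> turns the inner sum into a coefficient of
    \<open>ext_op (Suc h) F\<close>, by \<open>egf\<close>.\<close>
  also have "(\<Sum>s\<le>n. \<Sum>j=s..n. ?A (j - s) s * ?B (n - j) j * a s) =
      (\<Sum>j\<le>n. \<Sum>s\<le>j. ?A (j - s) s * ?B (n - j) j * a s)"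
    by (rule sum_triangle_swap)
  also have "\<dots> = (\<Sum>j\<le>n. ?B (n - j) j * fact j * ext_op (Suc h) F $ j)"
    unfolding mult.assoc egf by (simp add: sum_distrib_left mult_ac)
  also have "\<dots> = fact n * ext_op h (ext_op (Suc h) F) $ n"
    by (simp add: ext_op_def[of h])
  finally have "(\<Sum>s\<le>Suc n. ?A (Suc n - s) s * a s) =
      fact n * ext_op h (ext_op (Suc h) F) $ n - real n * a n + real (n + 2) * a (Suc n)" .
  moreover have "D (ext_op (Suc h) F) $ n = (\<Sum>s\<le>Suc n. ?A (Suc n - s) s * a s) / fact n"
    by (simp add: ext_op_def a_def mult_ac del: sum.atMost_Suc ext_count.simps)
  ultimately have "D (ext_op (Suc h) F) $ n - ext_op h (ext_op (Suc h) F) $ n =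
      real (n + 2) * a (Suc n) / fact n - real n * a n / fact n"
    by (simp add: add_divide_distrib diff_divide_distrib del: sum.atMost_Suc ext_count.simps)
  also have "\<dots> = (D (D (fps_X * F)) - fps_X * D F) $ n"
  proof -
    have "real (n + 2) * a (Suc n) / fact n = real (n + 2) * real (n + 1) * F $ Suc n"
      by (simp add: a_def)
    moreover have "real n * a n / fact n = real n * F $ n"
      by (simp add: a_def)
    moreover have "D (D (fps_X * F)) $ n = real (n + 2) * real (n + 1) * F $ Suc n"
      by (simp del: fps_deriv_mult)
    moreover have "(fps_X * D F) $ n = real n * F $ n"
      by (cases n) simp_all
    ultimately show ?thesis
      by (simp del: fps_deriv_mult)
  qed
  finally show "(D (ext_op (Suc h) F) - ext_op h (ext_op (Suc h) F)) $ n =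
      (D (D (fps_X * F)) - fps_X * D F) $ n"
    by simp
qed

section \<open>Factorization of the operators and the annihilation\<close>

lemma M_op_diff: "M_op k (F - G) = M_op k F - M_op k G"
proof (induction k arbitrary: F G rule: M_op.induct)
  case (3 k)
  have eq: "D (D (fps_X * (F - G))) - fps_X * D (F - G) =
      (D (D (fps_X * F)) - fps_X * D F) - (D (D (fps_X * G)) - fps_X * D G)"
    by (simp add: algebra_simps)
  show ?case
    unfolding M_op.simps(3) eq unfolding fps_deriv_sub 3 by (simp only: algebra_simps)
qed (simp_all add: algebra_simps)

lemma M_op_0_eq: "M_op 0 F = D F - ext_op 0 F"
  by (simp add: ext_op_0 algebra_simps)

lemma M_op_Suc_eq: "M_op (Suc k) F = M_op k (D F - ext_op (Suc k) F)"
proof (induction k arbitrary: F)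
  case 0
  \<comment> \<open>The recursion for \<open>M_op\<close> extends to \<open>M_op (Suc 0)\<close> if
    the identity is taken as the operator of index -1.\<close>
  have "M_op 0 (ext_op (Suc 0) F) = D (D (fps_X * F)) - fps_X * D F"
    unfolding M_op_0_eq deriv_ext_op_Suc ..
  then show ?case
    unfolding M_op_diff by (simp add: algebra_simps)
next
  case (Suc k)
  \<comment> \<open>The induction hypothesis puts \<open>D - ext_op (Suc k)\<close> in front of
    \<open>ext_op (Suc (Suc k)) F\<close>; \<open>deriv_ext_op_Suc\<close> evaluates this to the
    term subtracted in the recursion of \<open>M_op\<close>.\<close>
  have "M_op (Suc k) (ext_op (Suc (Suc k)) F) = M_op k (D (D (fps_X * F)) - fps_X * D F)"
    unfolding Suc deriv_ext_op_Suc ..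
  then show ?case
    unfolding M_op_diff[of "Suc k"] by simp
qed

theorem mainTheorem17:
  fixes k :: nat
  shows "M_op k (C_egf k) = 0"
proof -
  \<comment> \<open>Both \<open>D (D fps_X)\<close> and \<open>D 1\<close> vanish.\<close>
  have deriv: "D (ext_op (Suc h) 1) - ext_op h (ext_op (Suc h) 1) = 0" for h
    unfolding deriv_ext_op_Suc by simp
  show ?thesis
  proof (cases k)
    case 0
    then show ?thesis
      unfolding C_egf_eq using deriv[of 0] by (simp only: M_op_0_eq)
  next
    case (Suc j)
    \<comment> \<open>The instance of \<open>M_op_diff\<close> with both arguments 0 yields
      \<open>M_op j 0 = 0\<close>.\<close>
    then show ?thesis
      unfolding C_egf_eq using M_op_diff[of j 0 0] by (simp only: M_op_Suc_eq deriv) simp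
  qed
qed

end
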